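(* Let $\mathcal{E}_1$ and $\mathcal{E}_2$ be two isomorphic $3$-dimensional Volterra evolution algebras over $\mathbb{R}$ with the structural matrices $$A_{\mathcal{E}_1}=\begin{pmatrix} 0 & a_1 & -b_1 \\ -a_1 & 0 & c_1 \\ {b_1} & -c_1 & 0 \end{pmatrix},\qquad A_{\mathcal{E}_2}=\begin{pmatrix} 0 & a_2 & -b_2 \\ -a_2 & 0 & c_2 \\ {b_2} & -c_2 & 0 \end{pmatrix}$$ respectively, where $a_1b_1c_1\neq 0$, $a_2b_2c_2\neq 0$ and all entries have absolute value at most $1$. Then the corresponding Volterra quadratic stochastic operators $V_{A_{\mathcal{E}_1}}$ and $V_{A_{\mathcal{E}_2}}$ are either both ergodic or both non-ergodic.
   Context: An evolution algebra over a field $\mathbb{K}$ is a finite-dimensional $\mathbb{K}$-vector space $\mathcal{E}$ with a bilinear multiplication and a basis $\{e_1,\dots,e_n\}$ (called a natural basis) such that $e_ie_j=0$ for $i\neq j$ and $e_i^2=\sum_{k=1}^n a_{ik}e_k$. The matrix $A=(a_{ij})_{i,j=1}^n$ is the structural matrix of $\mathcal{E}$ in this natural basis. The evolution algebra is called a Volterra evolution algebra if $A$ is skew-symmetric. Two algebras are isomorphic if there is a bijective linear map $\psi$ between them with $\psi(uv)=\psi(u)\psi(v)$ for all $u,v$. Let $S^{m-1}=\{x\in\mathbb{R}^m: x_i\ge 0,\ \sum_{i=1}^m x_i=1\}$. For a real skew-symmetric matrix $A=(a_{ki})_{k,i=1}^m$ with $|a_{ki}|\le 1$, the corresponding Volterra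 quadratic stochastic operator $V_A:S^{m-1}\to S^{m-1}$ is $$(V_Ax)_k=x_k\Big(1+\sum_{i=1}^m a_{ki}x_i\Big),\qquad k=1,\dots,m.$$ Here $m=3$. The operator $V=V_A$ is ergodic if the limit $\lim_{n\to\infty}\frac1n\sum_{k=0}^{n-1}V^kx$ exists for every $x\in S^{m-1}$ (where $V^k$ is the $k$-th iterate of $V$), and non-ergodic otherwise. *)

theory Defs
  imports "HOL-Analysis.Analysis"
begin

locale bilinear_algebra = vector_space scale
  for scale :: "'k::field \<Rightarrow> 'v::ab_group_add \<Rightarrow> 'v" +
  fixes mul :: "'v \<Rightarrow> 'v \<Rightarrow> 'v"
  assumes linear_mult_right: "\<And>u. Vector_Spaces.linear scale scale (\<lambda>v. mul u v)"
    and linear_mult_left: "\<And>v. Vector_Spaces.linear scale scale (\<lambda>u. mul u v)"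

text \<open>
  An evolution algebra is taken together with a chosen natural basis, because the structural matrix
  (and hence the Volterra property) depends on it. The basis is a family indexed by the finite
  type \<open>'n\<close>, so the dimension is \<open>CARD('n)\<close>.
\<close>

locale evolution_algebra = bilinear_algebra scale mul
  for scale :: "'k::field \<Rightarrow> 'v::ab_group_add \<Rightarrow> 'v" and mul :: "'v \<Rightarrow> 'v \<Rightarrow> 'v" +
  fixes e :: "'n::finite \<Rightarrow> 'v"
  assumes inj_basis: "inj e"
    and independent_basis: "independent (range e)"
    and span_basis: "span (range e) = UNIV"
    and mult_basis_distinct: "\<And>i j. i \<noteq> j \<Longrightarrow> mul (e i) (e j) = 0"
begin

definition structural_matrix :: "'k^'n^'n" where
  "structural_matrix = (\<chi> i k. representation (range e) (mul (e i) (e i)) (e k))"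

lemma mult_basis_square: "mul (e i) (e i) = (\<Sum>k\<in>UNIV. scale (structural_matrix $ i $ k) (e k))"
proof -
  have "mul (e i) (e i) =
      (\<Sum>b\<in>range e. scale (representation (range e) (mul (e i) (e i)) b) b)"
    by (rule sum_representation_eq[symmetric]) (use independent_basis span_basis in auto)
  also have "\<dots> = (\<Sum>k\<in>UNIV. scale (structural_matrix $ i $ k) (e k))"
    by (simp add: sum.reindex[OF inj_basis] structural_matrix_def)
  finally show ?thesis .
qed

end

definition skew_symmetric :: "'k::ring^'n^'n \<Rightarrow> bool" where
  "skew_symmetric A \<longleftrightarrow> transpose A = - A"

locale volterra_evolution_algebra = evolution_algebra scale mul e
  for scale :: "'k::field \<Rightarrow> 'v::ab_group_add \<Rightarrow> 'v" and mul :: "'v \<Rightarrow> 'v \<Rightarrow> 'v"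
    and e :: "'n::finite \<Rightarrow> 'v" +
  assumes skew_symmetric_structural_matrix: "skew_symmetric structural_matrix"

definition isomorphic_algebras ::
  "('k::field \<Rightarrow> 'v::ab_group_add \<Rightarrow> 'v) \<Rightarrow> ('v \<Rightarrow> 'v \<Rightarrow> 'v) \<Rightarrow>
   ('k \<Rightarrow> 'w::ab_group_add \<Rightarrow> 'w) \<Rightarrow> ('w \<Rightarrow> 'w \<Rightarrow> 'w) \<Rightarrow> bool" where
  "isomorphic_algebras scale1 mul1 scale2 mul2 \<longleftrightarrow>
     (\<exists>\<psi>. Vector_Spaces.linear scale1 scale2 \<psi> \<and> bij \<psi> \<and>
          (\<forall>u v. \<psi> (mul1 u v) = mul2 (\<psi> u) (\<psi> v)))"

definition prob_simplex :: "(real^'n::finite) set" where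
  "prob_simplex = {x. (\<forall>i. 0 \<le> x $ i) \<and> (\<Sum>i\<in>UNIV. x $ i) = 1}"

text \<open>
  The operator is given by its formula on the whole space; it is an operator on the simplex when
  \<open>A\<close> is skew-symmetric with entries in \<open>[-1, 1]\<close>.
\<close>

definition volterra_qso :: "real^'n^'n \<Rightarrow> real^'n \<Rightarrow> real^'n::finite" where
  "volterra_qso A x = (\<chi> k. x $ k * (1 + (\<Sum>i\<in>UNIV. A $ k $ i * x $ i)))"

lemma volterra_qso_in_simplex:
  fixes A :: "real^'n::finite^'n"
  assumes skew: "skew_symmetric A" and bound: "\<And>k i. \<bar>A $ k $ i\<bar> \<le> 1"
    and x_in: "x \<in> prob_simplex"
  shows "volterra_qso A x \<in> prob_simplex"
proof -
  have nonneg: "\<And>i. 0 \<le> x $ i" and total: "(\<Sum>i\<in>UNIV. x $ i) = 1"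
    using x_in by (auto simp: prob_simplex_def)
  have "0 \<le> volterra_qso A x $ k" for k
  proof -
    have "- x $ i \<le> A $ k $ i * x $ i" for i
      using mult_right_mono[of "-1" "A $ k $ i" "x $ i"] bound[of k i] nonneg[of i] by (simp add: abs_le_iff)
    then have "(\<Sum>i\<in>UNIV. - x $ i) \<le> (\<Sum>i\<in>UNIV. A $ k $ i * x $ i)"
      by (intro sum_mono)
    then show ?thesis
      using nonneg[of k] total by (simp add: volterra_qso_def sum_negf)
  qed
  moreover have "(\<Sum>k\<in>UNIV. volterra_qso A x $ k) = 1"
  proof -
    have entry: "A $ i $ k = - A $ k $ i" for i k
    proof -
      have "transpose A $ k $ i = (- A) $ k $ i" using skew by (simp add: skew_symmetric_def)
      then show ?thesis by (simp add: transpose_def)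
    qed
    define s where "s = (\<Sum>k\<in>UNIV. \<Sum>i\<in>UNIV. x $ k * (A $ k $ i * x $ i))"
    have "s = (\<Sum>k\<in>UNIV. \<Sum>i\<in>UNIV. x $ i * (A $ i $ k * x $ k))"
      unfolding s_def by (rule sum.swap)
    also have "\<dots> = (\<Sum>k\<in>UNIV. \<Sum>i\<in>UNIV. - (x $ k * (A $ k $ i * x $ i)))"
    proof (intro sum.cong refl)
      fix k i
      show "x $ i * (A $ i $ k * x $ k) = - (x $ k * (A $ k $ i * x $ i))"
        using entry[of i k] by simp
    qed
    also have "\<dots> = - s"
      by (simp add: s_def sum_negf)
    finally have "s = 0" by simp
    then show ?thesis
      by (simp add: volterra_qso_def distrib_left sum.distrib total sum_distrib_left s_def)
  qed
  ultimately show ?thesis by (simp add: prob_simplex_def)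
qed

definition ergodic :: "(real^'n::finite \<Rightarrow> real^'n) \<Rightarrow> bool" where
  "ergodic V \<longleftrightarrow>
     (\<forall>x\<in>prob_simplex. convergent (\<lambda>n. (1 / real n) *\<^sub>R (\<Sum>k<n. (V ^^ k) x)))"

end

theory Submission
  imports Defs
begin

text \<open>
  In an isomorphism, the images of two distinct basis vectors multiply to \<open>0\<close>, so the componentwise
  product of their coordinate rows lies in the left kernel of the second structural matrix. This kernel
  is a line spanned by a vector without zero entries, and a nonzero product would make the third
  row proportional to one of the first two. Hence the rows have disjoint supports: the isomorphism permutes
  the natural bases up to scalars, and skew-symmetry forces these to have one sign. So whether the
  sign pattern of the matrix is cyclic (rock-paper-scissors) is an isomorphism invariant.

  If the pattern is not cyclic, every face of the simplex has a dominant vertex, which attracts the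
  interior of the face. If it is cyclic, with \<open>x\<close> feeding on \<open>y\<close>, \<open>y\<close> on \<open>z\<close> and \<open>z\<close> on \<open>x\<close> at rates
  \<open>a\<close>, \<open>b\<close>, \<open>c\<close>, then \<open>b ln x + c ln y + a ln z\<close> decreases at least linearly along a suitable orbit, so
  at time \<open>n\<close> one coordinate is below \<open>\<rho>\<^sup>n\<close> for a fixed \<open>\<rho> < 1\<close>. It needs a time proportional to \<open>n\<close> to become
  visible again, and meanwhile the orbit is stuck at a vertex; if the means converged, their limit
  would have to be that vertex. Since this happens infinitely often at two vertices at least, the means diverge.
\<close>

subsection \<open>Isomorphisms of Volterra evolution algebras\<close>

lemma skew_symmetricD:
  assumes "skew_symmetric A"
  shows "A $ i $ j = - A $ j $ i"
proof -
  have "transpose A $ j $ i = (- A) $ j $ i"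
    using assms by (simp add: skew_symmetric_def)
  then show ?thesis
    by (simp add: transpose_def)
qed

section \<open>Coordinates with respect to a natural basis\<close>

context evolution_algebra
begin

definition coord :: "'v \<Rightarrow> 'n \<Rightarrow> 'k" where
  "coord v k = representation (range e) v (e k)"

lemma sum_coord: "(\<Sum>k\<in>UNIV. scale (coord v k) (e k)) = v"
proof -
  have "v = (\<Sum>b\<in>range e. scale (representation (range e) v b) b)"
    by (rule sum_representation_eq[symmetric]) (use independent_basis span_basis in auto)
  also have "\<dots> = (\<Sum>k\<in>UNIV. scale (coord v k) (e k))"
    by (simp add: sum.reindex[OF inj_basis] coord_def)
  finally show ?thesis ..
qed

lemma coord_sum: "coord (\<Sum>i\<in>I. f i) k = (\<Sum>i\<in>I. coord (f i) k)"
  by (simp add: coord_def representation_sum independent_basis span_basis)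

lemma coord_scale: "coord (scale r v) k = r * coord v k"
  by (simp add: coord_def representation_scale independent_basis span_basis)

lemma coord_zero: "coord 0 k = 0"
  by (simp add: coord_def representation_zero)

lemma coord_eqI:
  assumes "\<And>k. coord u k = coord v k"
  shows "u = v"
  by (subst (1 2) sum_coord[symmetric]) (simp only: assms)

lemma coord_basis_square: "coord (mul (e i) (e i)) k = structural_matrix $ i $ k"
  by (simp add: coord_def structural_matrix_def)

lemma basis_not_proportional: "i \<noteq> j \<Longrightarrow> e i \<noteq> scale r (e j)"
proof
  assume "i \<noteq> j" "e i = scale r (e j)"
  moreover have "e j \<in> range e - {e i}"
    using \<open>i \<noteq> j\<close> inj_basis by (auto dest: injD)
  ultimately have "e i \<in> span (range e - {e i})"
    by (simp add: span_scale span_base)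
  then show False
    using independent_basis by (auto simp: dependent_def)
qed

lemma mul_eq_sum: "mul u v = (\<Sum>k\<in>UNIV. scale (coord u k * coord v k) (mul (e k) (e k)))"
proof -
  interpret left: Vector_Spaces.linear scale scale "\<lambda>u. mul u v"
    by (rule linear_mult_left)
  have square: "mul (e k) v = scale (coord v k) (mul (e k) (e k))" for k
  proof -
    interpret right: Vector_Spaces.linear scale scale "\<lambda>v. mul (e k) v"
      by (rule linear_mult_right)
    have "mul (e k) v = (\<Sum>j\<in>UNIV. scale (coord v j) (mul (e k) (e j)))"
      using right.sum[of "\<lambda>j. scale (coord v j) (e j)" UNIV] by (simp add: sum_coord right.scale)
    also have "\<dots> = (\<Sum>j\<in>UNIV. if j = k then scale (coord v k) (mul (e k) (e k)) else 0)"
      by (intro sum.cong refl) (use mult_basis_distinct[of k] in auto)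
    finally show ?thesis
      by simp
  qed
  have "mul u v = (\<Sum>k\<in>UNIV. scale (coord u k) (mul (e k) v))"
    using left.sum[of "\<lambda>k. scale (coord u k) (e k)" UNIV] by (simp add: sum_coord left.scale)
  then show ?thesis
    by (simp add: square)
qed

lemma coord_mul: "coord (mul u v) l = (\<Sum>k\<in>UNIV. coord u k * coord v k * structural_matrix $ k $ l)"
  by (subst mul_eq_sum) (simp add: coord_sum coord_scale coord_basis_square)

end

text \<open>Choosing one support index per row gives an injective, hence bijective, map. Every
  column is thus claimed by some row, and disjointness excludes any other row from it.\<close>

lemma disjoint_supports_imp_monomial:
  fixes P :: "'n::finite \<Rightarrow> 'n \<Rightarrow> 'k::idom"
  assumes nonzero: "\<And>i. \<exists>k. P i k \<noteq> 0" and disjoint: "\<And>i j k. i \<noteq> j \<Longrightarrow> P i k * P j k = 0"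
  obtains \<sigma> where "bij \<sigma>" "\<And>i k. P i k \<noteq> 0 \<longleftrightarrow> k = \<sigma> i"
proof -
  define \<sigma> where "\<sigma> i = (SOME k. P i k \<noteq> 0)" for i
  have \<sigma>: "P i (\<sigma> i) \<noteq> 0" for i
    using someI_ex[OF nonzero[of i]] by (simp add: \<sigma>_def)
  have "inj \<sigma>"
  proof (rule injI, rule ccontr)
    fix i j assume "\<sigma> i = \<sigma> j" "i \<noteq> j"
    then show False
      using disjoint[of i j "\<sigma> i"] \<sigma>[of i] \<sigma>[of j] by simp
  qed
  then have "bij \<sigma>"
    by (simp add: bij_def finite_UNIV_inj_surj)
  moreover have "P i k \<noteq> 0 \<longleftrightarrow> k = \<sigma> i" for i k
  proof
    assume "P i k \<noteq> 0"
    obtain j where "k = \<sigma> j"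
      using \<open>bij \<sigma>\<close> by (metis bij_pointE)
    with disjoint[of i j k] \<sigma>[of j] \<open>P i k \<noteq> 0\<close> show "k = \<sigma> i"
      by auto
  qed (use \<sigma> in simp)
  ultimately show thesis
    using that by blast
qed

text \<open>The left kernel of the structural matrix is spanned by \<open>(c, b, a)\<close>.\<close>

lemma skew_kernel_3:
  fixes a b c :: real and u v :: "3 \<Rightarrow> real" and A :: "real^3^3"
  assumes A: "A = vector [vector [0, a, - b], vector [- a, 0, c], vector [b, - c, 0]]"
    and nz: "a * b * c \<noteq> 0"
    and u: "\<And>l. (\<Sum>k\<in>UNIV. u k * A $ k $ l) = 0" and v: "\<And>l. (\<Sum>k\<in>UNIV. v k * A $ k $ l) = 0"
    and "u k\<^sub>0 \<noteq> 0"
  shows "u k \<noteq> 0" and "\<exists>r. \<forall>k. v k = r * u k"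
proof -
  \<comment> \<open>Columns 1 and 2 of the system already determine \<open>w\<close> from its third
    entry, because \<open>a\<close> is nonzero.\<close>
  have kernel: "w 1 = c / a * w 3 \<and> w 2 = b / a * w 3" if "\<And>l. (\<Sum>k\<in>UNIV. w k * A $ k $ l) = 0" for w :: "3 \<Rightarrow> real"
    using that[of 1] that[of 2] nz by (simp add: A sum_3 field_simps)
  have u3: "u 3 \<noteq> 0"
    using kernel[OF u] \<open>u k\<^sub>0 \<noteq> 0\<close> exhaust_3[of k\<^sub>0] by auto
  then show "u k \<noteq> 0"
    using kernel[OF u] nz exhaust_3[of k] by auto
  have "\<forall>k. v k = v 3 / u 3 * u k"
    using kernel[OF u] kernel[OF v] u3 by (simp add: forall_3)
  then show "\<exists>r. \<forall>k. v k = r * u k"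
    by blast
qed

text \<open>Products of consecutive entries cover both orientations of the cycle at once, and
  quantifying over all distinct triples makes the notion invariant under relabelling.\<close>

definition cyclic_signs :: "real^'n^'n \<Rightarrow> bool" where
  "cyclic_signs A \<longleftrightarrow> (\<forall>i j k. i \<noteq> j \<longrightarrow> j \<noteq> k \<longrightarrow> i \<noteq> k \<longrightarrow> 0 < A $ i $ j * A $ j $ k)"

text \<open>The coordinate matrix \<open>P\<close> of the isomorphism is monomial. The relation then
  compares two expressions for coordinate \<open>\<sigma> k\<close> of the image of a squared basis
  vector: as the square of an image, and through the expansion by \<open>A1\<close>.\<close>

lemma isomorphic_volterra_monomial:
  fixes scale1 :: "real \<Rightarrow> 'v::ab_group_add \<Rightarrow> 'v" and e1 :: "3 \<Rightarrow> 'v"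
    and scale2 :: "real \<Rightarrow> 'w::ab_group_add \<Rightarrow> 'w" and e2 :: "3 \<Rightarrow> 'w"
  assumes alg1: "evolution_algebra scale1 mul1 e1" and alg2: "evolution_algebra scale2 mul2 e2"
    and iso: "isomorphic_algebras scale1 mul1 scale2 mul2"
    and A1: "evolution_algebra.structural_matrix scale1 mul1 e1 = A1"
    and A2: "evolution_algebra.structural_matrix scale2 mul2 e2 = A2"
    and A2_eq: "A2 = vector [vector [0, a, - b], vector [- a, 0, c], vector [b, - c, 0]]"
    and nz: "a * b * c \<noteq> 0"
  obtains \<sigma> t where "bij \<sigma>" "\<And>i. t i \<noteq> 0" "\<And>i k. (t i)\<^sup>2 * A2 $ \<sigma> i $ \<sigma> k = t k * A1 $ i $ k"
proof -
  interpret E1: evolution_algebra scale1 mul1 e1 by (rule alg1)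
  interpret E2: evolution_algebra scale2 mul2 e2 by (rule alg2)
  obtain \<psi> where lin: "Vector_Spaces.linear scale1 scale2 \<psi>" and "bij \<psi>"
      and hom: "\<And>u v. \<psi> (mul1 u v) = mul2 (\<psi> u) (\<psi> v)"
    using iso by (auto simp: isomorphic_algebras_def)
  interpret \<psi>: Vector_Spaces.linear scale1 scale2 \<psi> by (rule lin)
  define P where "P i k = E2.coord (\<psi> (e1 i)) k" for i k
  have not_proportional: "\<not> (\<forall>k. P i k = r * P j k)" if "i \<noteq> j" for i j r
  proof
    assume "\<forall>k. P i k = r * P j k"
    then have "\<psi> (e1 i) = \<psi> (scale1 r (e1 j))"
      by (intro E2.coord_eqI) (simp add: \<psi>.scale E2.coord_scale P_def)
    then have "e1 i = scale1 r (e1 j)"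
      using \<open>bij \<psi>\<close> by (simp add: bij_def inj_eq)
    with E1.basis_not_proportional[OF that] show False
      by blast
  qed
  have orthogonal: "(\<Sum>k\<in>UNIV. (P i k * P j k) * A2 $ k $ l) = 0" if "i \<noteq> j" for i j l
    using hom[of "e1 i" "e1 j"] E2.coord_mul[of "\<psi> (e1 i)" "\<psi> (e1 j)" l] that
    by (simp add: E1.mult_basis_distinct \<psi>.zero E2.coord_zero P_def A2)
  \<comment> \<open>If the product of rows \<open>i\<close> and \<open>j\<close> is nonzero, it has
    no zero entry and the product of rows \<open>i\<close> and \<open>m\<close> is a multiple of it.
    Cancelling row \<open>i\<close> makes row \<open>m\<close> a multiple of row
    \<open>j\<close>.\<close>
  have disjoint: "P i k * P j k = 0" if ne: "i \<noteq> j" for i j k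
  proof (rule ccontr)
    assume nonzero: "P i k * P j k \<noteq> 0"
    have "card {i, j} \<le> 2"
      by (simp add: card_insert_if)
    then have "{i, j} \<noteq> UNIV"
      by (intro notI) simp
    then obtain m where m: "m \<noteq> i" "m \<noteq> j"
      by blast
    have "P i l \<noteq> 0" for l
      using skew_kernel_3(1)[OF A2_eq nz orthogonal[OF ne] orthogonal[OF ne] nonzero, of l] by simp
    moreover obtain r where "\<forall>l. P i l * P m l = r * (P i l * P j l)"
      using skew_kernel_3(2)[OF A2_eq nz orthogonal[OF ne] orthogonal[OF m(1)[symmetric]] nonzero] by blast
    ultimately have "\<forall>l. P m l = r * P j l"
      by simp
    with not_proportional[OF m(2)] show False
      by blast
  qed
  have nonzero: "\<exists>k. P i k \<noteq> 0" for i
  proof -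
    obtain j :: 3 where "i \<noteq> j"
      using exhaust_3[of i] by (metis zero_neq_one)
    \<comment> \<open>With factor \<open>0\<close>, non-proportionality says that row
      \<open>i\<close> is nonzero.\<close>
    with not_proportional[of i j 0] show ?thesis
      by auto
  qed
  obtain \<sigma> where "bij \<sigma>" and \<sigma>: "\<And>i k. P i k \<noteq> 0 \<longleftrightarrow> k = \<sigma> i"
    using disjoint_supports_imp_monomial[of P, OF nonzero disjoint] by blast
  have "(P i (\<sigma> i))\<^sup>2 * A2 $ \<sigma> i $ \<sigma> k = P k (\<sigma> k) * A1 $ i $ k" for i k
  proof -
    have "E2.coord (\<psi> (mul1 (e1 i) (e1 i))) (\<sigma> k) = (\<Sum>l\<in>UNIV. P i l * P i l * A2 $ l $ \<sigma> k)"
      by (simp add: hom E2.coord_mul P_def A2)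
    also have "\<dots> = (\<Sum>l\<in>UNIV. if l = \<sigma> i then (P i (\<sigma> i))\<^sup>2 * A2 $ \<sigma> i $ \<sigma> k else 0)"
      by (intro sum.cong refl) (use \<sigma> in \<open>auto simp: power2_eq_square\<close>)
    finally have "E2.coord (\<psi> (mul1 (e1 i) (e1 i))) (\<sigma> k) = (P i (\<sigma> i))\<^sup>2 * A2 $ \<sigma> i $ \<sigma> k"
      by simp
    moreover have "E2.coord (\<psi> (mul1 (e1 i) (e1 i))) (\<sigma> k) = (\<Sum>m\<in>UNIV. A1 $ i $ m * P m (\<sigma> k))"
      unfolding E1.mult_basis_square by (simp add: \<psi>.sum \<psi>.scale E2.coord_sum E2.coord_scale P_def A1)
    moreover have "\<dots> = (\<Sum>m\<in>UNIV. if m = k then P k (\<sigma> k) * A1 $ i $ k else 0)"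
      by (intro sum.cong refl) (use \<sigma> \<open>bij \<sigma>\<close> in \<open>auto simp: bij_def inj_eq\<close>)
    ultimately show ?thesis
      by simp
  qed
  moreover have "P i (\<sigma> i) \<noteq> 0" for i
    using \<sigma> by simp
  ultimately show thesis
    using that[of \<sigma> "\<lambda>i. P i (\<sigma> i)"] \<open>bij \<sigma>\<close> by simp
qed

text \<open>Comparing the relation at \<open>(j, k)\<close> and \<open>(k, j)\<close> through
  skew-symmetry equates the cubes of \<open>t j\<close> and \<open>t k\<close>, so all the scalars
  agree. Products of two entries then change only by a positive factor.\<close>

lemma cyclic_signs_monomial:
  fixes A B :: "real^'n^'n"
  assumes skew_A: "skew_symmetric A" and skew_B: "skew_symmetric B"
    and "bij \<sigma>" and t: "\<And>i. t i \<noteq> 0" and eq: "\<And>i k. (t i)\<^sup>2 * B $ \<sigma> i $ \<sigma> k = t k * A $ i $ k"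
    and offdiag: "\<And>i k. i \<noteq> k \<Longrightarrow> A $ i $ k \<noteq> 0"
  shows "cyclic_signs A \<longleftrightarrow> cyclic_signs B"
proof -
  have same_sign: "0 < t j * t k" if "j \<noteq> k" for j k
  proof -
    have "(t k)^3 * A $ j $ k = (t j)\<^sup>2 * (t k)\<^sup>2 * B $ \<sigma> j $ \<sigma> k"
      using eq[of j k] by (simp add: power2_eq_square power3_eq_cube)
    also have "\<dots> = - ((t j)\<^sup>2 * ((t k)\<^sup>2 * B $ \<sigma> k $ \<sigma> j))"
      using skew_symmetricD[OF skew_B, of "\<sigma> j" "\<sigma> k"] by simp
    also have "\<dots> = (t j)^3 * A $ j $ k"
      using eq[of k j] skew_symmetricD[OF skew_A, of j k] by (simp add: power2_eq_square power3_eq_cube)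
    finally have "(t k)^3 = (t j)^3"
      using offdiag[OF that] by simp
    then have "t j = t k"
      using odd_real_root_power_cancel[of 3 "t j"] odd_real_root_power_cancel[of 3 "t k"] by simp
    then show ?thesis
      using t[of k] by (auto simp: zero_less_mult_iff)
  qed
  have sign: "0 < A $ i $ j * A $ j $ k \<longleftrightarrow> 0 < B $ \<sigma> i $ \<sigma> j * B $ \<sigma> j $ \<sigma> k" if "j \<noteq> k" for i j k
  proof -
    have "t j * t k * (A $ i $ j * A $ j $ k) = ((t i)\<^sup>2 * B $ \<sigma> i $ \<sigma> j) * ((t j)\<^sup>2 * B $ \<sigma> j $ \<sigma> k)"
      by (simp only: eq) (simp add: mult_ac)
    also have "\<dots> = (t i * t j)\<^sup>2 * (B $ \<sigma> i $ \<sigma> j * B $ \<sigma> j $ \<sigma> k)"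
      by (simp add: power2_eq_square)
    finally have "0 < t j * t k * (A $ i $ j * A $ j $ k) \<longleftrightarrow> 0 < (t i * t j)\<^sup>2 * (B $ \<sigma> i $ \<sigma> j * B $ \<sigma> j $ \<sigma> k)"
      by simp
    moreover have "0 < (t i * t j)\<^sup>2"
      using t by simp
    ultimately show ?thesis
      using same_sign[OF that] by (simp add: zero_less_mult_iff[of "t j * t k"] zero_less_mult_iff[of "(t i * t j)\<^sup>2"])
  qed
  have inj: "\<sigma> i = \<sigma> j \<longleftrightarrow> i = j" for i j
    using \<open>bij \<sigma>\<close> by (simp add: bij_def inj_eq)
  have "cyclic_signs B \<longleftrightarrow> (\<forall>i\<in>range \<sigma>. \<forall>j\<in>range \<sigma>. \<forall>k\<in>range \<sigma>.
      i \<noteq> j \<longrightarrow> j \<noteq> k \<longrightarrow> i \<noteq> k \<longrightarrow> 0 < B $ i $ j * B $ j $ k)"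
    using \<open>bij \<sigma>\<close> by (simp add: cyclic_signs_def bij_is_surj)
  also have "\<dots> \<longleftrightarrow> cyclic_signs A"
    by (simp add: cyclic_signs_def inj sign cong: imp_cong)
  finally show ?thesis ..
qed

subsection \<open>Dominant vertices\<close>

lemma cesaro_mean_tendsto:
  fixes f :: "nat \<Rightarrow> 'a::real_normed_vector"
  assumes "f \<longlonglongrightarrow> l"
  shows "(\<lambda>n. (1 / real n) *\<^sub>R (\<Sum>k<n. f k)) \<longlonglongrightarrow> l"
proof (rule LIMSEQ_I)
  fix r :: real assume "0 < r"
  then obtain N where N: "\<And>k. N \<le> k \<Longrightarrow> norm (f k - l) < r / 2"
    using LIMSEQ_D[OF assms, of "r / 2"] by auto
  define C where "C = (\<Sum>k<N. norm (f k - l))"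
  have "0 \<le> C"
    by (simp add: C_def sum_nonneg)
  obtain M where M: "2 * C / r < real M"
    using reals_Archimedean2 by blast
  show "\<exists>n0. \<forall>n\<ge>n0. norm ((1 / real n) *\<^sub>R (\<Sum>k<n. f k) - l) < r"
  proof (intro exI allI impI)
    \<comment> \<open>\<open>M\<close> keeps the head \<open>C\<close> below half of the allowed
      error; \<open>N + 1\<close> makes \<open>n\<close> positive and puts the tail past
      \<open>N\<close>.\<close>
    fix n assume n: "max M (N + 1) \<le> n"
    have "0 < real n" and "C < r / 2 * real n"
      using n M \<open>0 < r\<close> by (auto simp: field_simps intro: less_le_trans)
    have "(\<Sum>k<n. norm (f k - l)) = C + (\<Sum>k\<in>{N..<n}. norm (f k - l))"
      using n by (simp add: C_def sum.union_disjoint[symmetric] ivl_disj_un ivl_disj_int)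
    also have "\<dots> \<le> C + (\<Sum>k\<in>{N..<n}. r / 2)"
      using N by (intro add_left_mono sum_mono) (simp add: less_imp_le)
    also have "\<dots> \<le> C + real n * (r / 2)"
      using \<open>0 < r\<close> by (simp add: mult_right_mono)
    also have "\<dots> < real n * r"
      using \<open>C < r / 2 * real n\<close> by (simp add: field_simps)
    finally have "norm (\<Sum>k<n. f k - l) < real n * r"
      using norm_sum[of "\<lambda>k. f k - l" "{..<n}"] by linarith
    moreover have "(1 / real n) *\<^sub>R (\<Sum>k<n. f k) - l = (1 / real n) *\<^sub>R (\<Sum>k<n. f k - l)"
      using \<open>0 < real n\<close> by (simp add: sum_subtractf scaleR_diff_right sum_constant_scaleR)
    ultimately show "norm ((1 / real n) *\<^sub>R (\<Sum>k<n. f k) - l) < r"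
      using \<open>0 < real n\<close> by (simp add: field_simps)
  qed
qed

section \<open>Orbits in the simplex and their convergence to a vertex\<close>

lemma prob_simplexD:
  assumes "x \<in> prob_simplex"
  shows "0 \<le> x $ i" "(\<Sum>i\<in>UNIV. x $ i) = 1" "x $ i \<le> 1"
proof -
  show nonneg: "0 \<le> x $ i" and total: "(\<Sum>i\<in>UNIV. x $ i) = 1" for i
    using assms by (auto simp: prob_simplex_def)
  show "x $ i \<le> 1"
    using member_le_sum[of i UNIV "\<lambda>i. x $ i"] nonneg total by simp
qed

lemma tendsto_axis_prob_simplex:
  fixes f :: "nat \<Rightarrow> real^'n"
  assumes simplex: "\<And>n. f n \<in> prob_simplex" and lim: "(\<lambda>n. f n $ k) \<longlonglongrightarrow> 1"
  shows "f \<longlonglongrightarrow> axis k 1"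
proof (rule vec_tendstoI)
  fix i
  show "(\<lambda>n. f n $ i) \<longlonglongrightarrow> axis k 1 $ i"
  proof (cases "i = k")
    case True
    with lim show ?thesis by simp
  next
    case False
    have le: "f n $ i \<le> 1 - f n $ k" for n
    proof -
      have "(\<Sum>j\<in>{i, k}. f n $ j) \<le> (\<Sum>j\<in>UNIV. f n $ j)"
        using prob_simplexD(1)[OF simplex] by (intro sum_mono2) auto
      then show ?thesis
        using False prob_simplexD(2)[OF simplex] by simp
    qed
    have "(\<lambda>n. 1 - f n $ k) \<longlonglongrightarrow> 1 - 1"
      by (intro tendsto_diff lim tendsto_const)
    then have "(\<lambda>n. f n $ i) \<longlonglongrightarrow> 0"
      using le prob_simplexD(1)[OF simplex]
      by (intro tendsto_sandwich[of "\<lambda>_. 0" "\<lambda>n. f n $ i" sequentially "\<lambda>n. 1 - f n $ k"]) auto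
    with False show ?thesis
      by (simp add: axis_def)
  qed
qed

lemma volterra_qso_iterate_in_simplex:
  fixes A :: "real^'n^'n"
  assumes "skew_symmetric A" "\<And>k i. \<bar>A $ k $ i\<bar> \<le> 1" "x \<in> prob_simplex"
  shows "(volterra_qso A ^^ n) x \<in> prob_simplex"
  using assms by (induction n) (auto intro: volterra_qso_in_simplex)

text \<open>Coordinate \<open>k\<close> grows by a factor of at least
  \<open>1 + \<delta> * (1 - f n $ k)\<close>, so it increases to a limit \<open>L\<close>. Passing
  to the limit in the increments leaves only \<open>L = 1\<close>.\<close>

lemma volterra_qso_tendsto_dominant_vertex:
  fixes A :: "real^'n^'n"
  assumes skew: "skew_symmetric A" and bound: "\<And>k i. \<bar>A $ k $ i\<bar> \<le> 1" and x: "x \<in> prob_simplex"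
    and "0 < x $ k" and dominant: "\<And>i. i \<noteq> k \<Longrightarrow> 0 < x $ i \<Longrightarrow> 0 < A $ k $ i"
  shows "(\<lambda>n. (volterra_qso A ^^ n) x) \<longlonglongrightarrow> axis k 1"
proof -
  define f where "f n = (volterra_qso A ^^ n) x" for n
  have simplex: "f n \<in> prob_simplex" for n
    unfolding f_def using volterra_qso_iterate_in_simplex[OF skew bound x] .
  note nonneg = prob_simplexD(1)[OF simplex] and total = prob_simplexD(2)[OF simplex]
  have step: "f (Suc n) $ i = f n $ i * (1 + (\<Sum>j\<in>UNIV. A $ i $ j * f n $ j))" for n i
    by (simp add: f_def volterra_qso_def)
  \<comment> \<open>Vanishing coordinates stay zero, so dominance is needed only on the support of
    \<open>x\<close>.\<close>
  have zero: "f n $ i = 0" if "x $ i = 0" for n i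
    using that by (induction n) (simp_all add: step, simp add: f_def)
  have "A $ k $ k = 0"
    using skew_symmetricD[OF skew, of k k] by simp
  \<comment> \<open>The extra element \<open>1\<close> covers the case that \<open>x\<close> is
    already the vertex and the other set is empty.\<close>
  define \<delta> where "\<delta> = Min (insert 1 ((\<lambda>i. A $ k $ i) ` {i. i \<noteq> k \<and> 0 < x $ i}))"
  have "0 < \<delta>"
    using dominant by (auto simp: \<delta>_def)
  have \<delta>_le: "\<delta> \<le> A $ k $ i" if "i \<noteq> k" "0 < x $ i" for i
    using that by (simp add: \<delta>_def)
  have rate: "\<delta> * (1 - f n $ k) \<le> (\<Sum>j\<in>UNIV. A $ k $ j * f n $ j)" for n
  proof -
    have "\<delta> * (1 - f n $ k) = (\<Sum>j\<in>UNIV - {k}. \<delta> * f n $ j)"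
      using total[of n] by (simp add: sum.remove[of UNIV k] flip: sum_distrib_left)
    also have "\<dots> \<le> (\<Sum>j\<in>UNIV - {k}. A $ k $ j * f n $ j)"
    proof (rule sum_mono)
      fix j assume "j \<in> UNIV - {k}"
      then show "\<delta> * f n $ j \<le> A $ k $ j * f n $ j"
        using \<delta>_le[of j] zero[of j n] nonneg[of n j] prob_simplexD(1)[OF x, of j]
        by (cases "x $ j = 0") (auto intro: mult_right_mono)
    qed
    also have "\<dots> = (\<Sum>j\<in>UNIV. A $ k $ j * f n $ j)"
      using \<open>A $ k $ k = 0\<close> by (simp add: sum.remove[of UNIV k])
    finally show ?thesis .
  qed
  have increment: "f n $ k * (\<delta> * (1 - f n $ k)) \<le> f (Suc n) $ k - f n $ k" for n
    using mult_left_mono[OF rate[of n] nonneg[of n k]] by (simp add: step algebra_simps)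
  have le_one: "f n $ k \<le> 1" for n
    by (rule prob_simplexD(3)[OF simplex])
  have mono: "incseq (\<lambda>n. f n $ k)"
  proof (rule incseq_SucI)
    fix n
    have "0 \<le> f n $ k * (\<delta> * (1 - f n $ k))"
      using nonneg[of n k] le_one[of n] \<open>0 < \<delta>\<close> by simp
    with increment[of n] show "f n $ k \<le> f (Suc n) $ k"
      by linarith
  qed
  then obtain L where L: "(\<lambda>n. f n $ k) \<longlonglongrightarrow> L"
    using incseq_convergent[of "\<lambda>n. f n $ k" 1] le_one by blast
  have "x $ k \<le> L"
    using incseq_le[OF mono L, of 0] by (simp add: f_def)
  have "L \<le> 1"
    using LIMSEQ_le_const2[OF L] le_one by blast
  have "L * (\<delta> * (1 - L)) \<le> L - L"
  proof (rule LIMSEQ_le)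
    show "(\<lambda>n. f n $ k * (\<delta> * (1 - f n $ k))) \<longlonglongrightarrow> L * (\<delta> * (1 - L))"
      by (intro tendsto_intros L)
    show "(\<lambda>n. f (Suc n) $ k - f n $ k) \<longlonglongrightarrow> L - L"
      by (intro tendsto_diff L LIMSEQ_Suc[OF L])
  qed (use increment in blast)
  then have "L = 1"
    using \<open>0 < x $ k\<close> \<open>x $ k \<le> L\<close> \<open>L \<le> 1\<close> \<open>0 < \<delta>\<close>
    by (simp add: mult_le_0_iff)
  with L tendsto_axis_prob_simplex[OF simplex] show ?thesis
    by (simp add: f_def)
qed

text \<open>Applied to the support of the starting point, the hypothesis gives convergence of the
  whole orbit, hence of its means.\<close>

lemma ergodic_if_dominant_vertices:
  fixes A :: "real^'n^'n"
  assumes skew: "skew_symmetric A" and bound: "\<And>k i. \<bar>A $ k $ i\<bar> \<le> 1"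
    and dominant: "\<And>S. S \<noteq> {} \<Longrightarrow> \<exists>k\<in>S. \<forall>i\<in>S. i \<noteq> k \<longrightarrow> 0 < A $ k $ i"
  shows "ergodic (volterra_qso A)"
  unfolding ergodic_def
proof
  fix x :: "real^'n" assume x: "x \<in> prob_simplex"
  have "{i. 0 < x $ i} \<noteq> {}"
  proof
    assume "{i. 0 < x $ i} = {}"
    then have "x $ i = 0" for i
      using prob_simplexD(1)[OF x, of i] by (auto simp: order.order_iff_strict)
    with prob_simplexD(2)[OF x] show False
      by simp
  qed
  from dominant[OF this] obtain k where "0 < x $ k" "\<And>i. i \<noteq> k \<Longrightarrow> 0 < x $ i \<Longrightarrow> 0 < A $ k $ i"
    by auto
  then have "(\<lambda>n. (volterra_qso A ^^ n) x) \<longlonglongrightarrow> axis k 1"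
    by (rule volterra_qso_tendsto_dominant_vertex[OF skew bound x])
  then show "convergent (\<lambda>n. (1 / real n) *\<^sub>R (\<Sum>k<n. (volterra_qso A ^^ k) x))"
    by (intro convergentI[OF cesaro_mean_tendsto])
qed

subsection \<open>Rock-paper-scissors orbits\<close>

lemma geometric_growth_unbounded:
  fixes f :: "nat \<Rightarrow> real"
  assumes "1 < r" and "0 < f N" and step: "\<And>n. N \<le> n \<Longrightarrow> r * f n \<le> f (Suc n)"
    and bounded: "\<And>n. N \<le> n \<Longrightarrow> f n \<le> B"
  shows False
proof -
  have lower: "r ^ m * f N \<le> f (N + m)" for m
  proof (induction m)
    case (Suc m)
    have "r ^ Suc m * f N \<le> r * f (N + m)"
      using mult_left_mono[OF Suc, of r] \<open>1 < r\<close> by (simp add: mult.assoc)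
    also have "\<dots> \<le> f (N + Suc m)"
      using step[of "N + m"] by simp
    finally show ?case .
  qed simp
  obtain m where "B / f N < r ^ m"
    using real_arch_pow[OF \<open>1 < r\<close>] by blast
  then have "B < r ^ m * f N"
    using \<open>0 < f N\<close> by (simp add: pos_divide_less_eq)
  with lower[of m] bounded[of "N + m"] show False
    by simp
qed

text \<open>The difference of the two sides has its minimum at \<open>0\<close>. The quadratic term
  is what later makes the Lyapunov function decrease strictly.\<close>

lemma ln_add_one_le_quadratic:
  fixes u :: real
  assumes "-1 < u" and "u \<le> 1"
  shows "ln (1 + u) \<le> u - u\<^sup>2 / 6"
proof -
  define g where "g v = v - v\<^sup>2 / 6 - ln (1 + v)" for v :: real
  have deriv: "(g has_real_derivative v * (2 - v) / (3 * (1 + v))) (at v)" if "-1 < v" for v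
    unfolding g_def using that
    by (auto intro!: derivative_eq_intros simp: field_simps power2_eq_square)
  have "g 0 \<le> g u"
  proof (cases "0 \<le> u")
    case True
    show ?thesis
    proof (rule DERIV_nonneg_imp_nondecreasing[OF True])
      fix v assume "0 \<le> v" "v \<le> u"
      with assms have "0 \<le> v * (2 - v) / (3 * (1 + v))"
        by simp
      with deriv[of v] \<open>0 \<le> v\<close> show "\<exists>d. (g has_real_derivative d) (at v) \<and> 0 \<le> d"
        by auto
    qed
  next
    case False
    show ?thesis
    proof (rule DERIV_nonpos_imp_nonincreasing[of u 0 g])
      fix v assume "u \<le> v" "v \<le> 0"
      with assms have "v * (2 - v) / (3 * (1 + v)) \<le> 0"
        by (intro divide_nonpos_nonneg mult_nonpos_nonneg) auto
      with deriv[of v] assms \<open>u \<le> v\<close> show "\<exists>d. (g has_real_derivative d) (at v) \<and> d \<le> 0"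
        by auto
    qed (use False in simp)
  qed
  then show ?thesis
    by (simp add: g_def)
qed

text \<open>Describing an interior orbit by three bare sequences makes its cyclic symmetry available
  through interpretation.\<close>

locale rock_paper_scissors =
  fixes a b c :: real and x y z :: "nat \<Rightarrow> real"
  assumes rates: "0 < a" "a \<le> 1" "0 < b" "b \<le> 1" "0 < c" "c \<le> 1"
    and pos: "\<And>n. 0 < x n" "\<And>n. 0 < y n" "\<And>n. 0 < z n"
    and total: "\<And>n. x n + y n + z n = 1"
    and step_x: "\<And>n. x (Suc n) = x n * (1 + a * y n - c * z n)"
    and step_y: "\<And>n. y (Suc n) = y n * (1 + b * z n - a * x n)"
    and step_z: "\<And>n. z (Suc n) = z n * (1 + c * x n - b * y n)"
begin

text \<open>Reinterpreting the locale along this rotation transfers each result to the other two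
  coordinates.\<close>

lemma rotate: "rock_paper_scissors b c a y z x"
  by unfold_locales (use rates pos total step_x step_y step_z in \<open>auto simp: algebra_simps\<close>)

lemma less_one: "x n < 1" "y n < 1" "z n < 1"
  using pos[of n] total[of n] by linarith+

lemma rate_mult_le: "a * y n \<le> y n" "c * z n \<le> z n" "b * z n \<le> z n" "a * x n \<le> x n" "c * x n \<le> x n" "b * y n \<le> y n"
  using rates pos[of n] by (simp_all add: mult_le_cancel_right2)

lemma rate_mult_pos: "0 < a * y n" "0 < c * z n" "0 < b * z n" "0 < a * x n" "0 < c * x n" "0 < b * y n"
  using rates pos[of n] by simp_all

text \<open>If \<open>z\<close> vanished, \<open>x\<close> would win against \<open>y\<close> and
  stay at least \<open>1 / 2\<close>; then \<open>y\<close> would decay geometrically, and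
  \<open>z\<close>, fed by \<open>x\<close>, would grow geometrically.\<close>

lemma not_tendsto_zero: "\<not> z \<longlonglongrightarrow> 0"
proof
  assume lim: "z \<longlonglongrightarrow> 0"
  have "\<forall>\<^sub>F n in sequentially. z n < a / 8"
    using order_tendstoD(2)[OF lim, of "a / 8"] rates by simp
  then obtain N where N: "\<And>n. N \<le> n \<Longrightarrow> z n < a / 8"
    by (auto simp: eventually_sequentially)
  have "\<exists>n\<ge>N. 1 / 2 \<le> x n"
  proof (rule ccontr)
    assume "\<not> ?thesis"
    then have small: "x n < 1 / 2" if "N \<le> n" for n
      using that by (meson not_le)
    \<comment> \<open>Here \<open>y n\<close> is at least \<open>1 / 4\<close>, so the gain
      \<open>a * y n\<close> is at least \<open>a / 4\<close>, while the loss \<open>c * z n\<close>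
      is below \<open>a / 8\<close>.\<close>
    have growth: "(1 + a / 8) * x n \<le> x (Suc n)" if "N \<le> n" for n
    proof -
      have "1 / 4 \<le> y n"
        using small[OF that] N[OF that] total[of n] rates by linarith
      then have "a / 4 \<le> a * y n"
        using mult_left_mono[of "1 / 4" "y n" a] rates by simp
      then have "1 + a / 8 \<le> 1 + a * y n - c * z n"
        using N[OF that] rate_mult_le(2)[of n] by linarith
      from mult_left_mono[OF this, of "x n"] show ?thesis
        using pos(1)[of n] by (simp add: step_x mult.commute)
    qed
    show False
      using geometric_growth_unbounded[of "1 + a / 8" x N "1/2"] growth small pos rates
      by (simp add: less_imp_le)
  qed
  then obtain M where M: "N \<le> M" "1 / 2 \<le> x M"
    by blast
  have large: "1 / 2 \<le> x n" if "M \<le> n" for n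
    using that
  proof (induction n rule: dec_induct)
    case (step n)
    \<comment> \<open>Either \<open>x\<close> does not decrease, or \<open>y\<close> and
      \<open>z\<close> are both below \<open>1 / 8\<close>; then \<open>x\<close> is at least
      \<open>3 / 4\<close> and loses at most an eighth of itself.\<close>
    show ?case
    proof (cases "z n \<le> a * y n")
      case True
      then have "1 \<le> 1 + a * y n - c * z n"
        using rate_mult_le(2)[of n] by linarith
      from mult_left_mono[OF this, of "x n"] have "x n \<le> x (Suc n)"
        using pos(1)[of n] by (simp add: step_x)
      with step show ?thesis
        by linarith
    next
      case False
      have zn: "z n < a / 8"
        using N step M by simp
      with False have "a * y n < a * (1 / 8)"
        by simp
      then have "y n < 1 / 8"
        using rates by (simp add: mult_less_cancel_left_pos)
      then have "3 / 4 \<le> x n" and "7 / 8 \<le> 1 + a * y n - c * z n"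
        using zn total[of n] rates rate_mult_le(2)[of n] rate_mult_pos(1)[of n] by linarith+
      from mult_mono[OF this] show ?thesis
        using pos(1)[of n] by (simp add: step_x)
    qed
  qed (use M in simp)
  have decay: "y (M + m) \<le> (1 - a / 4) ^ m" for m
  proof (induction m)
    case 0
    then show ?case using less_one(2)[of M] by simp
  next
    case (Suc m)
    have "a / 2 \<le> a * x (M + m)"
      using mult_left_mono[OF large[of "M + m"], of a] rates by simp
    moreover have "z (M + m) < a / 8"
      using N M by simp
    ultimately have "1 + b * z (M + m) - a * x (M + m) \<le> 1 - a / 4"
      using rate_mult_le(3)[of "M + m"] rates by linarith
    from mult_mono[OF Suc this] show ?case
      using pos(2)[of "M + m"] rates rate_mult_le(4)[of "M + m"] rate_mult_pos(3)[of "M + m"] less_one(1)[of "M + m"]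
      by (simp add: step_y mult.commute)
  qed
  have "(\<lambda>m. (1 - a / 4) ^ m) \<longlonglongrightarrow> 0"
    using rates by (intro LIMSEQ_realpow_zero) auto
  then have "\<forall>\<^sub>F m in sequentially. (1 - a / 4) ^ m < c / 4"
    using order_tendstoD(2)[of _ 0 sequentially "c / 4"] rates by simp
  then obtain K where K: "\<And>m. K \<le> m \<Longrightarrow> (1 - a / 4) ^ m < c / 4"
    by (auto simp: eventually_sequentially)
  have growth: "(1 + c / 4) * z n \<le> z (Suc n)" if n: "M + K \<le> n" for n
  proof -
    have "y n < c / 4"
      using decay[of "n - M"] K[of "n - M"] n by fastforce
    moreover have "c / 2 \<le> c * x n"
      using mult_left_mono[OF large[of n], of c] n rates by simp
    ultimately have "1 + c / 4 \<le> 1 + c * x n - b * y n"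
      using rate_mult_le(6)[of n] by linarith
    from mult_left_mono[OF this, of "z n"] show ?thesis
      using pos(3)[of n] by (simp add: step_z mult.commute)
  qed
  show False
    using geometric_growth_unbounded[of "1 + c / 4" z "M + K" 1] growth pos less_one rates
    by (simp add: less_imp_le)
qed

text \<open>Otherwise \<open>z\<close> is tiny at some late time and \<open>x\<close> is small
  whenever \<open>z\<close> is tiny. Then \<open>y\<close> dominates and shrinks \<open>z\<close> by
  the factor \<open>\<rho>\<close>, so \<open>z\<close> stays tiny forever and tends to
  \<open>0\<close>, which is impossible.\<close>

lemma frequently_large_or_not_tiny:
  assumes eps: "0 < \<epsilon>" "\<epsilon> \<le> b / 8" and rho: "1 - b / 4 \<le> \<rho>" "\<rho> < 1"
  shows "(\<exists>\<^sub>F n in sequentially. \<epsilon> \<le> x n \<and> z n \<le> \<rho> ^ n) \<or> (\<forall>\<^sub>F n in sequentially. \<rho> ^ n < z n)"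
proof (rule disjCI)
  assume not_tiny: "\<not> (\<forall>\<^sub>F n in sequentially. \<rho> ^ n < z n)"
  have rho_pos: "0 < \<rho>"
    using rho rates by linarith
  have pow: "(\<lambda>n. \<rho> ^ n) \<longlonglongrightarrow> 0"
    using rho rho_pos by (intro LIMSEQ_realpow_zero) auto
  show "\<exists>\<^sub>F n in sequentially. \<epsilon> \<le> x n \<and> z n \<le> \<rho> ^ n"
  proof (rule ccontr)
    assume "\<not> ?thesis"
    then have "\<forall>\<^sub>F n in sequentially. \<not> (\<epsilon> \<le> x n \<and> z n \<le> \<rho> ^ n)"
      by (simp add: not_frequently)
    then have "\<forall>\<^sub>F n in sequentially. \<not> (\<epsilon> \<le> x n \<and> z n \<le> \<rho> ^ n) \<and> \<rho> ^ n < 1 / 8"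
      using order_tendstoD(2)[OF pow, of "1 / 8"] by (auto intro: eventually_conj)
    then obtain N where N: "\<And>n. N \<le> n \<Longrightarrow> z n \<le> \<rho> ^ n \<Longrightarrow> x n < \<epsilon>"
        and N': "\<And>n. N \<le> n \<Longrightarrow> \<rho> ^ n < 1 / 8"
      unfolding eventually_sequentially by (meson not_le)
    obtain n0 where n0: "N \<le> n0" "z n0 \<le> \<rho> ^ n0"
      using not_tiny by (auto simp: eventually_sequentially not_less)
    have tiny: "z n \<le> \<rho> ^ n" if "n0 \<le> n" for n
      using that
    proof (induction n rule: dec_induct)
      case (step n)
      have "x n < b / 8"
        using N[of n] step n0 eps by simp
      moreover from this have "1 / 2 \<le> y n"
        using total[of n] N'[of n] step n0 rates by simp
      then have "b / 2 \<le> b * y n"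
        using mult_left_mono[of "1 / 2" "y n" b] rates by simp
      \<comment> \<open>The gain is below \<open>b / 8\<close> and the loss is at least
        \<open>b / 2\<close>, which is more than the required net loss \<open>b / 4\<close>.\<close>
      ultimately have "1 + c * x n - b * y n \<le> \<rho>"
        using rate_mult_le(5)[of n] rho rates by linarith
      moreover have "0 \<le> 1 + c * x n - b * y n"
        using rate_mult_pos(5)[of n] rate_mult_le(6)[of n] less_one(2)[of n] by linarith
      ultimately have "z n * (1 + c * x n - b * y n) \<le> \<rho> ^ n * \<rho>"
        using step rho_pos by (intro mult_mono) auto
      then show ?case
        by (simp add: step_z mult.commute)
    qed (use n0 in simp)
    have "z \<longlonglongrightarrow> 0"
    proof (rule tendsto_sandwich[OF _ _ tendsto_const pow])
      show "\<forall>\<^sub>F n in sequentially. 0 \<le> z n"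
        using pos by (simp add: less_imp_le)
      show "\<forall>\<^sub>F n in sequentially. z n \<le> \<rho> ^ n"
        using tiny by (auto simp: eventually_sequentially)
    qed
    with not_tendsto_zero show False ..
  qed
qed

text \<open>
  While \<open>z\<close> is tiny the first species feeds on the second, and \<open>x (k + 1) - x k \<ge> a x k y k - c z k\<close>
  bounds the total mass of \<open>y\<close> over the whole block by a constant.
\<close>

lemma block_sum_lower_bound:
  assumes eps: "0 < \<epsilon>" "\<epsilon> \<le> x n" and tiny: "2 ^ L * z n \<le> \<epsilon> / 2" "\<epsilon> \<le> 1"
  shows "real L - 4 / (a * \<epsilon>) \<le> (\<Sum>k<L. x (n + k))"
proof -
  \<comment> \<open>The coordinate \<open>z\<close> at most doubles per step, so its sum over the
    block is controlled by its initial value.\<close>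
  have z_le: "z (n + k) \<le> 2 ^ k * z n" for k
  proof (induction k)
    case (Suc k)
    have "1 + c * x (n + k) - b * y (n + k) \<le> 2"
      using rate_mult_le(5)[of "n + k"] rate_mult_pos(6)[of "n + k"] less_one(1)[of "n + k"] by linarith
    from mult_left_mono[OF this, of "z (n + k)"] have "z (n + Suc k) \<le> z (n + k) * 2"
      using pos(3)[of "n + k"] by (simp add: step_z)
    with Suc show ?case
      by simp
  qed simp
  have sum_z: "(\<Sum>k<m. z (n + k)) \<le> \<epsilon> / 2" if "m \<le> L" for m
  proof -
    have "(\<Sum>k<m. z (n + k)) \<le> (\<Sum>k<m. 2 ^ k * z n)"
      by (intro sum_mono z_le)
    also have "\<dots> = (2 ^ m - 1) * z n"
      using geometric_sum[of "2 :: real" m] by (simp flip: sum_distrib_right)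
    also have "\<dots> \<le> 2 ^ L * z n"
      using pos(3)[of n] power_increasing[OF that, of "2 :: real"] by (intro mult_right_mono; linarith)
    finally show ?thesis
      using tiny by simp
  qed
  have incr: "a * x k * y k - z k \<le> x (Suc k) - x k" for k
  proof -
    have "x k * (c * z k) \<le> 1 * z k"
      using rate_mult_le(2)[of k] less_one(1)[of k] pos[of k] rates by (intro mult_mono) auto
    then show ?thesis
      by (simp add: step_x algebra_simps)
  qed
  have gain: "(\<Sum>k<m. a * x (n + k) * y (n + k)) \<le> x (n + m) - x n + \<epsilon> / 2" if "m \<le> L" for m
  proof -
    have "(\<Sum>k<m. a * x (n + k) * y (n + k) - z (n + k)) \<le> (\<Sum>k<m. x (n + Suc k) - x (n + k))"
      using incr by (intro sum_mono) simp
    also have "\<dots> = x (n + m) - x n"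
      using sum_lessThan_telescope[of "\<lambda>k. x (n + k)" m] by simp
    finally show ?thesis
      using sum_z[OF that] by (simp add: sum_subtractf)
  qed
  \<comment> \<open>Feeding on \<open>y\<close> only helps \<open>x\<close>, and \<open>z\<close>
    costs it at most \<open>\<epsilon> / 2\<close> over the whole block.\<close>
  have x_ge: "\<epsilon> / 2 \<le> x (n + m)" if "m \<le> L" for m
  proof -
    have "0 \<le> (\<Sum>k<m. a * x (n + k) * y (n + k))"
      using rates pos by (intro sum_nonneg) (simp add: less_imp_le)
    with gain[OF that] eps show ?thesis by linarith
  qed
  have "(\<Sum>k<L. a * (\<epsilon> / 2) * y (n + k)) \<le> (\<Sum>k<L. a * x (n + k) * y (n + k))"
    using x_ge rates pos by (intro sum_mono mult_right_mono mult_left_mono) (auto simp: less_imp_le)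
  also have "\<dots> \<le> 1"
    using gain[of L] less_one(1)[of "n + L"] eps by simp
  finally have "a * (\<epsilon> / 2) * (\<Sum>k<L. y (n + k)) \<le> 1"
    by (simp only: sum_distrib_left)
  then have "(\<Sum>k<L. y (n + k)) \<le> 2 / (a * \<epsilon>)"
    using rates eps by (simp add: field_simps)
  moreover have "(\<Sum>k<L. z (n + k)) \<le> 2 / (a * \<epsilon>)"
  proof -
    have "a * \<epsilon> \<le> 1" 
      using rates eps tiny by (simp add: mult_le_one)
    then have "1 \<le> 2 / (a * \<epsilon>)"
      using rates eps by (simp add: field_simps)
    with sum_z[of L] tiny(2) show ?thesis by simp
  qed
  moreover have "real L = (\<Sum>k<L. x (n + k) + y (n + k) + z (n + k))"
    by (simp add: total)
  ultimately show ?thesis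
    by (simp add: sum.distrib)
qed

text \<open>At the times \<open>n\<close> given by \<open>freq\<close>, \<open>z\<close> stays tiny
  for a block whose length \<open>L\<close> is proportional to \<open>n\<close>, and
  \<open>x\<close> is nearly \<open>1\<close> there on average. Since the means at \<open>n\<close>
  and at \<open>n + L\<close> are both close to \<open>q\<close>, this forces \<open>q\<close> to be
  almost \<open>1\<close>.\<close>

lemma mean_limit_ge_one:
  assumes eps: "0 < \<epsilon>" "\<epsilon> \<le> 1" and rho: "0 < \<rho>" "\<rho> < 1"
    and freq: "\<exists>\<^sub>F n in sequentially. \<epsilon> \<le> x n \<and> z n \<le> \<rho> ^ n"
    and lim: "(\<lambda>n. (\<Sum>k<n. x k) / real n) \<longlonglongrightarrow> q"
  shows "1 \<le> q"
proof (rule field_le_epsilon)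
  fix e :: real assume "0 < e"
  \<comment> \<open>With this \<open>p\<close>, \<open>z n\<close> is at most
    \<open>(1 / 4) ^ L\<close> for \<open>L = n div p\<close>, which outweighs the \<open>L\<close>
    possible doublings.\<close>
  obtain p where p: "\<rho> ^ p < 1 / 4"
    using real_arch_pow_inv[of "1 / 4" \<rho>] rho by auto
  have "p \<noteq> 0"
    using p by (intro notI) simp
  \<comment> \<open>The two means contribute an error of \<open>d * (2 * n + L)\<close>, at most
    \<open>d * 5 * p * L\<close>, which this choice makes \<open>e / 2 * L\<close>.\<close>
  define d where "d = e / (10 * real p)"
  have "0 < d"
    using \<open>0 < e\<close> \<open>p \<noteq> 0\<close> by (simp add: d_def)
  define K where "K = 4 / (a * \<epsilon>)"
  have "\<forall>\<^sub>F n in sequentially. dist ((\<Sum>k<n. x k) / real n) q < d"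
    using lim \<open>0 < d\<close> by (simp add: tendsto_iff)
  then obtain N where N: "\<And>n. N \<le> n \<Longrightarrow> dist ((\<Sum>k<n. x k) / real n) q < d"
    by (auto simp: eventually_sequentially)
  \<comment> \<open>The first bound makes \<open>(1 / 2) ^ L\<close> at most
    \<open>\<epsilon> / 2\<close>, the second makes \<open>K / L\<close> at most
    \<open>e / 2\<close>, once \<open>L\<close> exceeds \<open>M\<close>.\<close>
  obtain M :: nat where M: "1 / \<epsilon> < real M" "2 * K / e < real M"
    by (metis gt_ex linorder_not_less max_less_iff_conj reals_Archimedean2)
  obtain n where n: "max (N + 1) (p * (M + 1)) \<le> n" "\<epsilon> \<le> x n" "z n \<le> \<rho> ^ n"
    using freq unfolding frequently_sequentially by blast
  define L where "L = n div p"
  have "M + 1 \<le> L"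
    using n(1) \<open>p \<noteq> 0\<close> by (simp add: L_def less_eq_div_iff_mult_less_eq mult.commute)
  have "p * L \<le> n" and "n < p * (L + 1)"
    using \<open>p \<noteq> 0\<close> by (simp_all add: L_def mult.commute dividend_less_times_div)
  have mean: "\<bar>(\<Sum>k<m. x k) - q * real m\<bar> \<le> d * real m" if "n \<le> m" for m
  proof -
    have "0 < real m" and "\<bar>(\<Sum>k<m. x k) / real m - q\<bar> < d"
      using N[of m] that n by (simp_all add: dist_real_def)
    moreover have "(\<Sum>k<m. x k) - q * real m = ((\<Sum>k<m. x k) / real m - q) * real m"
      using \<open>0 < real m\<close> by (simp add: field_simps)
    ultimately show ?thesis
      by (simp add: abs_mult mult_right_mono)
  qed
  have "2 ^ L * z n \<le> \<epsilon> / 2"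
  proof -
    have "z n \<le> \<rho> ^ (p * L)"
      using n(3) power_decreasing[OF \<open>p * L \<le> n\<close>, of \<rho>] rho by linarith
    also have "\<dots> \<le> (1 / 4) ^ L"
      using p rho by (simp add: power_mult power_mono)
    finally have "2 ^ L * z n \<le> 2 ^ L * (1 / 4) ^ L"
      by simp
    also have "\<dots> = (1 / 2) ^ L"
      by (simp flip: power_mult_distrib)
    also have "\<dots> \<le> (1 / 2) ^ (M + 1)"
      using \<open>M + 1 \<le> L\<close> by (intro power_decreasing) auto
    also have "\<dots> \<le> 1 / (2 * real M)"
    proof -
      have "real M \<le> 2 ^ M"
        using of_nat_less_two_power[of M, where 'a = real] by linarith
      moreover have "0 < real M" using M(1) eps by (smt (verit) divide_pos_pos)
      ultimately show ?thesis by (simp add: field_simps)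
    qed
    also have "\<dots> \<le> \<epsilon> / 2"
    proof -
      have "0 < real M" using M(1) eps by (smt (verit) divide_pos_pos)
      then show ?thesis using M(1) eps by (simp add: field_simps)
    qed
    finally show ?thesis .
  qed
  then have "real L - K \<le> (\<Sum>k<L. x (n + k))"
    unfolding K_def using block_sum_lower_bound[of \<epsilon> n L] eps n by simp
  also have "\<dots> = (\<Sum>k<n + L. x k) - (\<Sum>k<n. x k)"
  proof -
    have "(\<Sum>k<n + L. x k) = (\<Sum>k<n. x k) + (\<Sum>k<L. x (n + k))"
      by (induction L) simp_all
    then show ?thesis by simp
  qed
  also have "\<dots> \<le> q * real L + d * (2 * real n + real L)"
    using mean[of n] mean[of "n + L"] by (simp add: algebra_simps abs_le_iff)
  also have "d * (2 * real n + real L) \<le> d * (5 * real p * real L)"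
  proof (intro mult_left_mono)
    have "n \<le> p * L + p"
      using \<open>n < p * (L + 1)\<close> by simp
    moreover have "p \<le> p * L" and "L \<le> p * L"
      using \<open>M + 1 \<le> L\<close> \<open>p \<noteq> 0\<close> by simp_all
    ultimately have "2 * n + L \<le> 5 * (p * L)"
      by linarith
    then have "real (2 * n + L) \<le> real (5 * (p * L))"
      by (simp only: of_nat_le_iff)
    then show "2 * real n + real L \<le> 5 * real p * real L"
      by simp
  qed (use \<open>0 < d\<close> in simp)
  also have "d * (5 * real p * real L) = e / 2 * real L"
    using \<open>p \<noteq> 0\<close> by (simp add: d_def)
  finally have "real L * 1 \<le> real L * (q + e / 2 + K / real L)"
    using \<open>M + 1 \<le> L\<close> by (simp add: algebra_simps)
  then have "1 \<le> q + e / 2 + K / real L"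
    using \<open>M + 1 \<le> L\<close> by simp
  moreover have "K / real L \<le> e / 2"
  proof -
    have "2 * K / e < real L" using M \<open>M + 1 \<le> L\<close> by linarith
    then show ?thesis using \<open>0 < e\<close> \<open>M + 1 \<le> L\<close> by (simp add: field_simps)
  qed
  ultimately show "1 \<le> q + e" by linarith
qed


text \<open>If two coordinates were eventually not tiny, the third would tend to \<open>0\<close>.
  So at least two are tiny infinitely often, and each of these forces a different mean limit to be
  at least \<open>1\<close>, although the limits are nonnegative with sum \<open>1\<close>.\<close>

lemma not_all_means_convergent:
  assumes rho0: "\<rho>\<^sub>0 < 1" and tiny: "\<And>n. x n \<le> \<rho>\<^sub>0 ^ n \<or> y n \<le> \<rho>\<^sub>0 ^ n \<or> z n \<le> \<rho>\<^sub>0 ^ n" "0 < \<rho>\<^sub>0"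
    and lim_x: "(\<lambda>n. (\<Sum>k<n. x k) / real n) \<longlonglongrightarrow> p"
    and lim_y: "(\<lambda>n. (\<Sum>k<n. y k) / real n) \<longlonglongrightarrow> q"
    and lim_z: "(\<lambda>n. (\<Sum>k<n. z k) / real n) \<longlonglongrightarrow> r"
  shows False
proof -
  interpret yzx: rock_paper_scissors b c a y z x
    by (rule rotate)
  interpret zxy: rock_paper_scissors c a b z x y
    by (rule yzx.rotate)
  define s where "s = min a (min b c)"
  have s: "0 < s" "s \<le> a" "s \<le> b" "s \<le> c"
    using rates by (auto simp: s_def)
  \<comment> \<open>Enlarging \<open>\<rho>\<^sub>0\<close> preserves the tininess bounds and meets
    the condition on \<open>\<rho>\<close> for all three rotations at once.\<close>
  define \<rho> where "\<rho> = max \<rho>\<^sub>0 (1 - s / 4)"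
  have rho: "0 < \<rho>" "\<rho> < 1" "1 - s / 4 \<le> \<rho>" "\<rho>\<^sub>0 \<le> \<rho>"
    using rho0 tiny(2) s by (auto simp: \<rho>_def)
  have pow: "(\<lambda>n. \<rho> ^ n) \<longlonglongrightarrow> 0"
    using rho by (intro LIMSEQ_realpow_zero) auto
  have tiny': "x n \<le> \<rho> ^ n \<or> y n \<le> \<rho> ^ n \<or> z n \<le> \<rho> ^ n" for n
  proof -
    have "\<rho>\<^sub>0 ^ n \<le> \<rho> ^ n"
      using rho tiny(2) by (intro power_mono) auto
    with tiny(1)[of n] show ?thesis by linarith
  qed
  have to_zero: "w \<longlonglongrightarrow> 0" if "\<And>n. 0 < w n" "\<forall>\<^sub>F n in sequentially. w n \<le> \<rho> ^ n" for w
    using that by (intro tendsto_sandwich[OF _ _ tendsto_const pow]) (auto simp: less_imp_le)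
  define X where "X \<longleftrightarrow> (\<forall>\<^sub>F n in sequentially. \<rho> ^ n < x n)"
  define Y where "Y \<longleftrightarrow> (\<forall>\<^sub>F n in sequentially. \<rho> ^ n < y n)"
  define Z where "Z \<longleftrightarrow> (\<forall>\<^sub>F n in sequentially. \<rho> ^ n < z n)"
  have "\<not> (X \<and> Y)"
  proof
    assume "X \<and> Y"
    then have "\<forall>\<^sub>F n in sequentially. \<rho> ^ n < x n \<and> \<rho> ^ n < y n"
      by (simp add: X_def Y_def eventually_conj)
    then have "\<forall>\<^sub>F n in sequentially. z n \<le> \<rho> ^ n"
      by eventually_elim (use tiny' in \<open>meson not_le\<close>)
    with to_zero[of z] pos not_tendsto_zero show False by blast
  qed
  moreover have "\<not> (Y \<and> Z)"
  proof
    assume "Y \<and> Z"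
    then have "\<forall>\<^sub>F n in sequentially. \<rho> ^ n < y n \<and> \<rho> ^ n < z n"
      by (simp add: Y_def Z_def eventually_conj)
    then have "\<forall>\<^sub>F n in sequentially. x n \<le> \<rho> ^ n"
      by eventually_elim (use tiny' in \<open>meson not_le\<close>)
    with to_zero[of x] pos yzx.not_tendsto_zero show False by blast
  qed
  moreover have "\<not> (Z \<and> X)"
  proof
    assume "Z \<and> X"
    then have "\<forall>\<^sub>F n in sequentially. \<rho> ^ n < z n \<and> \<rho> ^ n < x n"
      by (simp add: X_def Z_def eventually_conj)
    then have "\<forall>\<^sub>F n in sequentially. y n \<le> \<rho> ^ n"
      by eventually_elim (use tiny' in \<open>meson not_le\<close>)
    with to_zero[of y] pos zxy.not_tendsto_zero show False by blast
  qed
  moreover have "1 \<le> p \<or> Z"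
    using frequently_large_or_not_tiny[of "s / 8" \<rho>] mean_limit_ge_one[of "s / 8" \<rho> p] s rho rates lim_x
    by (auto simp: Z_def)
  moreover have "1 \<le> q \<or> X"
    using yzx.frequently_large_or_not_tiny[of "s / 8" \<rho>] yzx.mean_limit_ge_one[of "s / 8" \<rho> q] s rho rates lim_y
    by (auto simp: X_def)
  moreover have "1 \<le> r \<or> Y"
    using zxy.frequently_large_or_not_tiny[of "s / 8" \<rho>] zxy.mean_limit_ge_one[of "s / 8" \<rho> r] s rho rates lim_z
    by (auto simp: Y_def)
  moreover have "0 \<le> p" "0 \<le> q" "0 \<le> r"
    by (rule tendsto_lowerbound[OF lim_x] tendsto_lowerbound[OF lim_y] tendsto_lowerbound[OF lim_z],
        simp_all add: pos less_imp_le sum_nonneg)+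
  moreover have "p + q + r = 1"
  proof -
    have "(\<lambda>n. (\<Sum>k<n. x k) / real n + (\<Sum>k<n. y k) / real n + (\<Sum>k<n. z k) / real n) \<longlonglongrightarrow> p + q + r"
      by (intro tendsto_add lim_x lim_y lim_z)
    moreover have "\<forall>\<^sub>F n in sequentially. (\<Sum>k<n. x k) / real n + (\<Sum>k<n. y k) / real n + (\<Sum>k<n. z k) / real n = 1"
      using eventually_gt_at_top[of 0]
      by eventually_elim (simp add: total flip: add_divide_distrib sum.distrib)
    ultimately show ?thesis
      by (rule LIMSEQ_unique[OF _ tendsto_eventually])
  qed
  ultimately show False
    by auto
qed

section \<open>A Lyapunov function and exponential approach to the boundary\<close>

lemma coordinates_bounded_below_if_large:
  assumes s: "0 < s" "s \<le> a" "s \<le> b" "s \<le> c" and "1 / 3 \<le> x n"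
    and "\<bar>b * z n - a * x n\<bar> \<le> s / 6" "\<bar>c * x n - b * y n\<bar> \<le> s / 6"
  shows "s / 6 \<le> x n" "s / 6 \<le> y n" "s / 6 \<le> z n"
proof -
  \<comment> \<open>Both \<open>a * x n\<close> and \<open>c * x n\<close> are at least
    \<open>s / 3\<close>; near balance, \<open>b * z n\<close> and \<open>b * y n\<close> can fall
    short of them by at most \<open>s / 6\<close>.\<close>
  have "s * (1 / 3) \<le> a * x n" "s * (1 / 3) \<le> c * x n"
    using assms rates by (intro mult_mono; simp)+
  then show "s / 6 \<le> y n" "s / 6 \<le> z n"
    using assms rate_mult_le(3,6)[of n] unfolding abs_le_iff by linarith+
  show "s / 6 \<le> x n"
    using assms rates by linarith
qed

text \<open>The weights \<open>b\<close>, \<open>c\<close>, \<open>a\<close> are, up to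
  normalisation, the coordinates of the interior fixed point.\<close>

definition lyapunov :: "nat \<Rightarrow> real" where
  "lyapunov n = b * ln (x n) + c * ln (y n) + a * ln (z n)"

text \<open>The weights make the first-order terms of the logarithms cancel, so only the quadratic
  losses remain.\<close>

lemma lyapunov_Suc_le:
  "lyapunov (Suc n) \<le> lyapunov n -
    (b * (a * y n - c * z n)\<^sup>2 + c * (b * z n - a * x n)\<^sup>2 + a * (c * x n - b * y n)\<^sup>2) / 6"
proof -
  define u v w where "u = a * y n - c * z n" and "v = b * z n - a * x n" and "w = c * x n - b * y n"
  have range: "-1 < u" "u \<le> 1" "-1 < v" "v \<le> 1" "-1 < w" "w \<le> 1"
    using rate_mult_le[of n] rate_mult_pos[of n] less_one[of n] unfolding u_def v_def w_def by linarith+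
  have "lyapunov (Suc n) = lyapunov n + (b * ln (1 + u) + c * ln (1 + v) + a * ln (1 + w))"
  proof -
    have "x (Suc n) = x n * (1 + u)" "y (Suc n) = y n * (1 + v)" "z (Suc n) = z n * (1 + w)"
      by (simp_all add: step_x step_y step_z u_def v_def w_def)
    then have "ln (x (Suc n)) = ln (x n) + ln (1 + u)" "ln (y (Suc n)) = ln (y n) + ln (1 + v)"
        "ln (z (Suc n)) = ln (z n) + ln (1 + w)"
      using range pos[of n] by (simp_all add: ln_mult)
    then show ?thesis
      by (simp add: lyapunov_def algebra_simps)
  qed
  also have "b * ln (1 + u) + c * ln (1 + v) + a * ln (1 + w)
      \<le> b * (u - u\<^sup>2 / 6) + c * (v - v\<^sup>2 / 6) + a * (w - w\<^sup>2 / 6)"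
    using range rates by (intro add_mono mult_left_mono ln_add_one_le_quadratic) auto
  also have "\<dots> = - ((b * u\<^sup>2 + c * v\<^sup>2 + a * w\<^sup>2) / 6) + (b * u + c * v + a * w)"
    by (simp add: field_simps)
  also have "b * u + c * v + a * w = 0"
    by (simp add: u_def v_def w_def algebra_simps)
  finally have "lyapunov (Suc n) \<le> lyapunov n - (b * u\<^sup>2 + c * v\<^sup>2 + a * w\<^sup>2) / 6"
    by simp
  then show ?thesis
    by (simp only: u_def v_def w_def)
qed

text \<open>The weights sum to at most \<open>3\<close> and \<open>ln m\<close> is nonpositive. Used
  contrapositively: a very negative value forces some coordinate to be small.\<close>

lemma ln_le_lyapunov:
  assumes "0 < m" "m \<le> 1" "m \<le> x n" "m \<le> y n" "m \<le> z n"
  shows "3 * ln m \<le> lyapunov n"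
proof -
  have "(a + b + c) * (- ln m) \<le> 3 * (- ln m)"
    using assms rates by (intro mult_right_mono) auto
  moreover have "b * ln m + c * ln m + a * ln m \<le> lyapunov n"
    unfolding lyapunov_def using assms rates pos[of n] by (intro add_mono mult_left_mono) auto
  ultimately show ?thesis
    by (simp add: algebra_simps)
qed

text \<open>Below the threshold some coordinate is under \<open>s / 6\<close>, so some growth rate
  exceeds \<open>s / 6\<close> in modulus and the Lyapunov function drops by a fixed
  \<open>\<kappa>\<close>. It therefore stays below the threshold and decreases at least
  linearly.\<close>

lemma exponentially_close_to_boundary:
  assumes s: "0 < s" "s \<le> a" "s \<le> b" "s \<le> c" and start: "lyapunov 0 < 3 * ln (s / 6)"
  obtains \<rho> where "0 < \<rho>" "\<rho> < 1" "\<And>n. x n \<le> \<rho> ^ n \<or> y n \<le> \<rho> ^ n \<or> z n \<le> \<rho> ^ n"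
proof -
  interpret yzx: rock_paper_scissors b c a y z x
    by (rule rotate)
  interpret zxy: rock_paper_scissors c a b z x y
    by (rule yzx.rotate)
  define \<kappa> where "\<kappa> = s * (s / 6)\<^sup>2 / 6"
  have "0 < \<kappa>"
    using s by (simp add: \<kappa>_def)
  have decrease: "lyapunov (Suc n) \<le> lyapunov n - \<kappa>" if small: "lyapunov n < 3 * ln (s / 6)" for n
  proof -
    have "\<not> (s / 6 \<le> x n \<and> s / 6 \<le> y n \<and> s / 6 \<le> z n)"
      using ln_le_lyapunov[of "s / 6" n] small s rates by auto
    moreover have "1 / 3 \<le> x n \<or> 1 / 3 \<le> y n \<or> 1 / 3 \<le> z n"
      using total[of n] by linarith
    \<comment> \<open>If all three rates were small, the rotation placing a coordinate of size at
      least \<open>1 / 3\<close> first would bound every coordinate below by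
      \<open>s / 6\<close>.\<close>
    ultimately have "s / 6 < \<bar>a * y n - c * z n\<bar> \<or> s / 6 < \<bar>b * z n - a * x n\<bar> \<or> s / 6 < \<bar>c * x n - b * y n\<bar>"
      using coordinates_bounded_below_if_large[of s n] yzx.coordinates_bounded_below_if_large[of s n]
        zxy.coordinates_bounded_below_if_large[of s n] s by (meson not_le)
    moreover have sq: "s * (s / 6)\<^sup>2 \<le> d * t\<^sup>2" if "s / 6 < \<bar>t\<bar>" "s \<le> d" for d t
      using that s power_mono[of "s / 6" "\<bar>t\<bar>" 2] by (intro mult_mono) auto
    moreover have "0 \<le> b * (a * y n - c * z n)\<^sup>2" "0 \<le> c * (b * z n - a * x n)\<^sup>2" "0 \<le> a * (c * x n - b * y n)\<^sup>2"
      using rates by simp_all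
    ultimately have "s * (s / 6)\<^sup>2 \<le> b * (a * y n - c * z n)\<^sup>2 + c * (b * z n - a * x n)\<^sup>2 + a * (c * x n - b * y n)\<^sup>2"
      using s by (smt (verit))
    then show ?thesis
      unfolding \<kappa>_def by (intro order_trans[OF lyapunov_Suc_le] diff_left_mono divide_right_mono) auto
  qed
  have bound: "lyapunov n \<le> lyapunov 0 - real n * \<kappa>" for n
  proof (induction n)
    case (Suc n)
    have "lyapunov n < 3 * ln (s / 6)"
      using Suc start \<open>0 < \<kappa>\<close> by (smt (verit) mult_nonneg_nonneg of_nat_0_le_iff)
    from decrease[OF this] Suc show ?case
      by (simp add: algebra_simps)
  qed simp
  \<comment> \<open>Chosen so that \<open>3 * ln (\<rho> ^ n)\<close> equals
    \<open>- (real n * \<kappa>)\<close>.\<close>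
  define \<rho> where "\<rho> = exp (- \<kappa> / 3)"
  have "ln (s / 6) < 0"
    using s rates by simp
  have "x n \<le> \<rho> ^ n \<or> y n \<le> \<rho> ^ n \<or> z n \<le> \<rho> ^ n" for n
  proof (rule ccontr)
    assume "\<not> ?thesis"
    moreover have "0 < \<rho> ^ n" "\<rho> ^ n \<le> 1"
      using \<open>0 < \<kappa>\<close> by (simp_all add: \<rho>_def power_le_one)
    ultimately have "3 * ln (\<rho> ^ n) \<le> lyapunov n"
      by (intro ln_le_lyapunov) auto
    moreover have "3 * ln (\<rho> ^ n) = - (real n * \<kappa>)"
      by (simp add: \<rho>_def ln_realpow)
    ultimately show False
      using bound[of n] start \<open>ln (s / 6) < 0\<close> by linarith
  qed
  moreover have "0 < \<rho>" "\<rho> < 1"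
    using \<open>0 < \<kappa>\<close> by (simp_all add: \<rho>_def)
  ultimately show thesis
    using that by blast
qed

end

subsection \<open>The ergodicity dichotomy\<close>

lemma non_ergodic_if_cyclic_dominance:
  fixes A :: "real^3^3"
  assumes skew: "skew_symmetric A" and bound: "\<And>k i. \<bar>A $ k $ i\<bar> \<le> 1"
    and distinct: "i \<noteq> j" "j \<noteq> k" "i \<noteq> k"
    and signs: "0 < A $ i $ j" "0 < A $ j $ k" "0 < A $ k $ i"
  shows "\<not> ergodic (volterra_qso A)"
proof
  assume ergodic: "ergodic (volterra_qso A)"
  have UNIV_eq: "(UNIV :: 3 set) = {i, j, k}"
    by (rule sym, rule card_subset_eq) (use distinct in auto)
  have sum_eq: "(\<Sum>l\<in>UNIV. g l) = g i + g j + g k" for g :: "3 \<Rightarrow> real"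
    unfolding UNIV_eq using distinct by simp
  define s where "s = min (A $ i $ j) (min (A $ j $ k) (A $ k $ i))"
  have s: "0 < s" "s \<le> A $ i $ j" "s \<le> A $ j $ k" "s \<le> A $ k $ i"
    using signs by (auto simp: s_def)
  have "s \<le> 1"
    using s(2) bound[of i j] by linarith
  \<comment> \<open>This gives \<open>s * ln t = 3 * ln (s / 6) - s\<close>. Coordinate
    \<open>i\<close>, of weight at least \<open>s\<close>, alone pushes the initial Lyapunov value
    below the threshold; the other two terms are not positive.\<close>
  define t where "t = exp (3 * ln (s / 6) / s - 1)"
  have "3 * ln (s / 6) / s < 0"
    using s(1) \<open>s \<le> 1\<close> by (simp add: divide_neg_pos)
  then have t: "0 < t" "t < 1" "ln t < 0"
    by (simp_all add: t_def)
  have "s * ln t < 3 * ln (s / 6)"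
    using s(1) by (simp add: t_def algebra_simps)
  define x0 :: "real^3" where "x0 = (\<chi> l. if l = i then t else (1 - t) / 2)"
  define f where "f n = (volterra_qso A ^^ n) x0" for n
  have x0_entries: "f 0 $ i = t" "f 0 $ j = (1 - t) / 2" "f 0 $ k = (1 - t) / 2"
    using distinct by (simp_all add: f_def x0_def)
  have "x0 \<in> prob_simplex"
    using x0_entries t unfolding prob_simplex_def by (auto simp: f_def sum_eq x0_def)
  then have simplex: "f n \<in> prob_simplex" for n
    unfolding f_def by (rule volterra_qso_iterate_in_simplex[OF skew bound])
  have skew_entry: "A $ l $ m = - A $ m $ l" for l m
    using skew by (rule skew_symmetricD)
  have diag: "A $ l $ l = 0" for l
    using skew_entry[of l l] by simp
  have step: "f (Suc n) $ l = f n $ l * (1 + (\<Sum>m\<in>UNIV. A $ l $ m * f n $ m))" for n l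
    by (simp add: f_def volterra_qso_def)
  have total: "f n $ i + f n $ j + f n $ k = 1" for n
    using prob_simplexD(2)[OF simplex[of n]] by (simp add: sum_eq)
  have step_i: "f (Suc n) $ i = f n $ i * (1 + A $ i $ j * f n $ j - A $ k $ i * f n $ k)" for n
    using skew_entry[of i k] by (simp add: step sum_eq diag)
  have step_j: "f (Suc n) $ j = f n $ j * (1 + A $ j $ k * f n $ k - A $ i $ j * f n $ i)" for n
    using skew_entry[of j i] by (simp add: step sum_eq diag)
  have step_k: "f (Suc n) $ k = f n $ k * (1 + A $ k $ i * f n $ i - A $ j $ k * f n $ j)" for n
    using skew_entry[of k j] by (simp add: step sum_eq diag)
  \<comment> \<open>Each loss is below \<open>1\<close>, so an orbit starting in the interior never
    reaches the boundary.\<close>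
  have factor_pos: "0 < 1 + r * u - r' * v" if "0 < r" "0 < r'" "r' \<le> 1" "0 < u" "0 < v" "v < 1" for r r' u v :: real
  proof -
    have "r' * v \<le> v"
      using that by (simp add: mult_le_cancel_right2)
    then show ?thesis
      using that mult_pos_pos[of r u] by linarith
  qed
  have le_one: "A $ i $ j \<le> 1" "A $ j $ k \<le> 1" "A $ k $ i \<le> 1"
    using bound by (simp_all add: abs_le_iff)
  have pos: "0 < f n $ i \<and> 0 < f n $ j \<and> 0 < f n $ k" for n
  proof (induction n)
    case 0
    then show ?case
      using t by (simp add: x0_entries)
  next
    case (Suc n)
    then have "f n $ i < 1" "f n $ j < 1" "f n $ k < 1"
      using total[of n] by linarith+
    with Suc show ?case
      using signs le_one unfolding step_i step_j step_k by (intro conjI mult_pos_pos factor_pos) auto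
  qed
  interpret rock_paper_scissors "A $ i $ j" "A $ j $ k" "A $ k $ i" "\<lambda>n. f n $ i" "\<lambda>n. f n $ j" "\<lambda>n. f n $ k"
    by unfold_locales (use signs le_one pos total step_i step_j step_k in auto)
  have "lyapunov 0 < 3 * ln (s / 6)"
  proof -
    have "A $ j $ k * ln t \<le> s * ln t"
      using s t by (intro mult_right_mono_neg) auto
    moreover have "A $ k $ i * ln ((1 - t) / 2) + A $ i $ j * ln ((1 - t) / 2) \<le> 0"
      using t signs by (intro add_nonpos_nonpos mult_nonneg_nonpos) auto
    ultimately show ?thesis
      using \<open>s * ln t < 3 * ln (s / 6)\<close> unfolding lyapunov_def x0_entries by linarith
  qed
  then obtain \<rho> where \<rho>: "0 < \<rho>" "\<rho> < 1" "\<And>n. f n $ i \<le> \<rho> ^ n \<or> f n $ j \<le> \<rho> ^ n \<or> f n $ k \<le> \<rho> ^ n"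
    using exponentially_close_to_boundary[OF s] by blast
  obtain q where q: "(\<lambda>n. (1 / real n) *\<^sub>R (\<Sum>k<n. f k)) \<longlonglongrightarrow> q"
    using ergodic \<open>x0 \<in> prob_simplex\<close> unfolding ergodic_def convergent_def f_def by blast
  have mean: "(\<lambda>n. (\<Sum>k<n. f k $ l) / real n) \<longlonglongrightarrow> q $ l" for l
    using tendsto_vec_nth[OF q, of l] by simp
  show False
    by (rule not_all_means_convergent[OF \<rho>(2,3,1) mean mean mean])
qed

lemma volterra_3_entries:
  fixes a b c :: real and A :: "real^3^3"
  assumes "A = vector [vector [0, a, - b], vector [- a, 0, c], vector [b, - c, 0]]"
  shows "A $ 1 $ 1 = 0" "A $ 1 $ 2 = a" "A $ 1 $ 3 = - b" "A $ 2 $ 1 = - a" "A $ 2 $ 2 = 0" "A $ 2 $ 3 = c"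
    "A $ 3 $ 1 = b" "A $ 3 $ 2 = - c" "A $ 3 $ 3 = 0"
  using assms by simp_all

lemma ergodic_iff_not_cyclic_signs:
  fixes A :: "real^3^3"
  assumes A: "A = vector [vector [0, a, - b], vector [- a, 0, c], vector [b, - c, 0]]"
    and nz: "a * b * c \<noteq> 0" and skew: "skew_symmetric A" and bound: "\<And>i j. \<bar>A $ i $ j\<bar> \<le> 1"
  shows "ergodic (volterra_qso A) \<longleftrightarrow> \<not> cyclic_signs A"
proof -
  note entries = volterra_3_entries[OF A]
  have cyclic_iff: "cyclic_signs A \<longleftrightarrow> 0 < a \<and> 0 < b \<and> 0 < c \<or> a < 0 \<and> b < 0 \<and> c < 0"
    by (auto simp: cyclic_signs_def forall_3 entries zero_less_mult_iff)
  show ?thesis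
  proof
    assume ergodic: "ergodic (volterra_qso A)"
    show "\<not> cyclic_signs A"
      \<comment> \<open>The two orders of the indices treat the all-positive and the all-negative
        case.\<close>
      using non_ergodic_if_cyclic_dominance[OF skew bound, of 1 2 3]
        non_ergodic_if_cyclic_dominance[OF skew bound, of 1 3 2] ergodic
      by (auto simp: cyclic_iff entries)
  next
    assume not_cyclic: "\<not> cyclic_signs A"
    have ex_3: "(\<exists>k::3. Q k) \<longleftrightarrow> Q 1 \<or> Q 2 \<or> Q 3" for Q
      by (metis exhaust_3)
    show "ergodic (volterra_qso A)"
    proof (rule ergodic_if_dominant_vertices[OF skew bound])
      fix S :: "3 set" assume "S \<noteq> {}"
      then have "1 \<in> S \<or> 2 \<in> S \<or> 3 \<in> S"
        using ex_3[of "\<lambda>k. k \<in> S"] by blast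
      moreover have "a \<noteq> 0" "b \<noteq> 0" "c \<noteq> 0"
        using nz by auto
      \<comment> \<open>A tournament on three vertices without a cycle is transitive, so each
        nonempty set of vertices has a dominant one.\<close>
      ultimately show "\<exists>k\<in>S. \<forall>i\<in>S. i \<noteq> k \<longrightarrow> 0 < A $ k $ i"
        using not_cyclic unfolding Bex_def Ball_def ex_3 forall_3 cyclic_iff
        by (auto simp: entries linorder_neq_iff)
    qed
  qed
qed

theorem theorem5p6:
  fixes scale1 :: "real \<Rightarrow> 'v::ab_group_add \<Rightarrow> 'v" and mul1 :: "'v \<Rightarrow> 'v \<Rightarrow> 'v" and e1 :: "3 \<Rightarrow> 'v"
    and scale2 :: "real \<Rightarrow> 'w::ab_group_add \<Rightarrow> 'w" and mul2 :: "'w \<Rightarrow> 'w \<Rightarrow> 'w" and e2 :: "3 \<Rightarrow> 'w"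
    and A1 A2 :: "real^3^3" and a1 b1 c1 a2 b2 c2 :: real
  assumes "volterra_evolution_algebra scale1 mul1 e1"
    and "volterra_evolution_algebra scale2 mul2 e2"
    and "isomorphic_algebras scale1 mul1 scale2 mul2"
    and "evolution_algebra.structural_matrix scale1 mul1 e1 = A1"
    and "evolution_algebra.structural_matrix scale2 mul2 e2 = A2"
    and "A1 = vector [vector [0, a1, - b1], vector [- a1, 0, c1], vector [b1, - c1, 0]]"
    and "A2 = vector [vector [0, a2, - b2], vector [- a2, 0, c2], vector [b2, - c2, 0]]"
    and "a1 * b1 * c1 \<noteq> 0" and "a2 * b2 * c2 \<noteq> 0"
    and "\<And>i j. \<bar>A1 $ i $ j\<bar> \<le> 1" and "\<And>i j. \<bar>A2 $ i $ j\<bar> \<le> 1"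
  shows "(ergodic (volterra_qso A1) \<and> ergodic (volterra_qso A2)) \<or>
         (\<not> ergodic (volterra_qso A1) \<and> \<not> ergodic (volterra_qso A2))"
proof -
  interpret E1: volterra_evolution_algebra scale1 mul1 e1 by fact
  interpret E2: volterra_evolution_algebra scale2 mul2 e2 by fact
  have skew: "skew_symmetric A1" "skew_symmetric A2"
    using E1.skew_symmetric_structural_matrix E2.skew_symmetric_structural_matrix assms(4,5) by simp_all
  obtain \<sigma> t where "bij \<sigma>" "\<And>i. t i \<noteq> 0" "\<And>i k. (t i)\<^sup>2 * A2 $ \<sigma> i $ \<sigma> k = t k * A1 $ i $ k"
    using isomorphic_volterra_monomial[OF E1.evolution_algebra_axioms E2.evolution_algebra_axioms
        assms(3,4,5,7,9)] by metis
  moreover have "A1 $ i $ k \<noteq> 0" if "i \<noteq> k" for i k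
    using that assms(8) exhaust_3[of i] exhaust_3[of k] by (auto simp: volterra_3_entries[OF assms(6)])
  ultimately have "cyclic_signs A1 \<longleftrightarrow> cyclic_signs A2"
    by (intro cyclic_signs_monomial skew)
  then show ?thesis
    using ergodic_iff_not_cyclic_signs[OF assms(6,8) skew(1) assms(10)]
      ergodic_iff_not_cyclic_signs[OF assms(7,9) skew(2) assms(11)] by blast
qed

end
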